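(* Let $M_{AC}(r_1,r_2,z,k)$ be the Moore bound for mixed Abelian Cayley graphs, where $r_1,r_2,z,k\ge 0$ are integers. Depending on the values of $r_1$, $r_2$, and $z$, the Moore bounds for the mixed Abelian Cayley graphs are: (i) For any values of $r_1,r_2,z$, $$M_{AC}(r_1,r_2,z,k)=\sum_{j=0}^{r_1+r_2}\binom{r_1+r_2}{j}\binom{k+r_2+z-j}{z+r_2}.$$ (ii) If $r_1\le z$, $$M_{AC}(r_1,r_2,z,k)=\sum_{i=0}^{r_1+r_2}\binom{r_1+r_2}{i}\binom{k+z}{i+z}2^i.$$ (iii) If $r_1\ge z$, $$M_{AC}(r_1,r_2,z,k)=\sum_{i=0}^{r_2+z}\binom{r_2+z}{i}2^i\sum_{j=0}^{r_1-z}\binom{r_1}{j}\binom{k-j}{i}.$$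
   Context: A mixed Abelian Cayley graph is a Cayley graph $\mathrm{Cay}(\Gamma,\Sigma)$ of an Abelian group $\Gamma$ whose generating set $\Sigma$ contains $r_1$ involutions, $r_2$ pairs of generators $\pm a$, and $z$ generators $b$ with $-b\notin\Sigma$. The Moore bound for such graphs with diameter $k$ is the upper bound on the number of vertices given by $$M_{AC}(r_1,r_2,z,k)=\sum_{i=0}^{r_2}\binom{r_2}{i}2^i\sum_{j=0}^{r_1}\binom{r_1}{j}\binom{k+z-j}{i+z}.$$ Convention: $\binom{a}{b}=0$ whenever $a<0$ or $b>a$ (with $b\ge 0$).
   Formalization: In (ii), binom(k+z, i+z) is corrected to binom(k+z-r_1, i+z-r_1), and in (iii), binom(r_1, j) to binom(r_1-z, j); as printed, (ii) fails at (r_1,r_2,z,k)=(1,0,1,1) (3 vs 4) and (iii) at (2,0,1,1) (4 vs 5). *)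

theory Defs
  imports Main
begin

text \<open>
  The upper argument is an integer because expressions such as \<open>k - j\<close> can be negative;
  the coefficient is then 0. This differs from the generalised binomial
  coefficient \<open>gchoose\<close>, where for instance a negative integer over 0 is 1.
  For \<open>0 \<le> a < int b\<close> the value is 0 by \<open>binomial_eq_0\<close>.
\<close>
definition binom :: "int \<Rightarrow> nat \<Rightarrow> nat" where
  "binom a b = (if a < 0 then 0 else nat a choose b)"

definition M_AC :: "nat \<Rightarrow> nat \<Rightarrow> nat \<Rightarrow> nat \<Rightarrow> nat" where
  "M_AC r1 r2 z k =
     (\<Sum>i=0..r2. (r2 choose i) * 2 ^ i *
        (\<Sum>j=0..r1. (r1 choose j) * binom (int k + int z - int j) (i + z)))"

end

theory Submission
  imports Defs
begin

text \<open>
  All four sums are instances of \<open>M_AC r s t k\<close>, which is the coefficient of \<open>x^k\<close> in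
  \<open>(1 + x)^(r + s) / (1 - x)^(s + t + 1)\<close> and so depends only on \<open>r + s\<close> and \<open>s + t\<close>:
  Pascal's rule trades a pair of generators \<open>\<plusminus>a\<close> for one involution and one generator
  without inverse. The four instances are \<open>(r1, r2, z)\<close>, \<open>(r1 + r2, 0, z + r2)\<close>,
  \<open>(0, r1 + r2, z - r1)\<close> and \<open>(r1 - z, r2 + z, 0)\<close>.
\<close>

text \<open>The convention for negative arguments is harmless here: at \<open>a = -1\<close> all
  three terms vanish, because the lower index on the left is positive.\<close>

lemma binom_Suc: "binom (a + 1) (Suc b) = binom a b + binom a (Suc b)"
proof (cases "a < 0")
  case True
  then have "a + 1 < 0 \<or> a + 1 = 0" by linarith
  with True show ?thesis by (auto simp: binom_def)
next
  case False
  then have "nat (a + 1) = Suc (nat a)" by (simp add: nat_add_distrib)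
  with False show ?thesis by (simp add: binom_def)
qed

text \<open>With \<open>E\<close> the shift of \<open>g\<close>, this is
  \<open>(1 + E)^(n + 1) = (1 + E)^n (1 + E)\<close> evaluated at index 0.\<close>

lemma sum_choose_Suc:
  fixes g :: "nat \<Rightarrow> 'a :: comm_semiring_1"
  shows "(\<Sum>i=0..Suc n. of_nat (Suc n choose i) * g i) =
         (\<Sum>i=0..n. of_nat (n choose i) * (g i + g (Suc i)))"
proof -
  have "(\<Sum>i=0..Suc n. of_nat (Suc n choose i) * g i) =
      g 0 + (\<Sum>i=0..n. of_nat (n choose Suc i) * g (Suc i)) +
      (\<Sum>i=0..n. of_nat (n choose i) * g (Suc i))"
    by (subst sum.atLeast0_atMost_Suc_shift)
      (simp add: distrib_right sum.distrib add_ac)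
  also have "g 0 + (\<Sum>i=0..n. of_nat (n choose Suc i) * g (Suc i)) =
      (\<Sum>i=0..Suc n. of_nat (n choose i) * g i)"
    by (subst sum.atLeast0_atMost_Suc_shift) simp
  also have "\<dots> = (\<Sum>i=0..n. of_nat (n choose i) * g i)"
    by (simp add: binomial_eq_0)
  finally show ?thesis
    by (simp add: distrib_left sum.distrib)
qed

text \<open>Splitting off a pair on the left, or an involution on the right, turns each side into
  the sum of \<open>(s choose i) * 2 ^ i * (f i + 2 * f (Suc i))\<close>.\<close>

lemma M_AC_Suc: "M_AC r (Suc s) t k = M_AC (Suc r) s (Suc t) k"
proof -
  define f where "f i = (\<Sum>j=0..r. (r choose j) * binom (int k + int t - int j) (i + t))" for i
  have step: "(\<Sum>j=0..Suc r. (Suc r choose j) * binom (int k + int (Suc t) - int j) (i + Suc t)) =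
      f i + 2 * f (Suc i)" for i
  proof -
    \<comment> \<open>The second term has upper argument \<open>int k + int t - int j\<close>, so
      Pascal's rule on the first term alone produces another copy of it, hence the factor 2.\<close>
    have pascal: "binom (int k + int (Suc t) - int j) (i + Suc t) +
        binom (int k + int (Suc t) - int (Suc j)) (i + Suc t) =
        binom (int k + int t - int j) (i + t) + 2 * binom (int k + int t - int j) (Suc i + t)" for j
      using binom_Suc[of "int k + int t - int j" "i + t"] by (simp add: algebra_simps)
    show ?thesis
      using sum_choose_Suc[of r "\<lambda>j. binom (int k + int (Suc t) - int j) (i + Suc t)"]
      unfolding pascal by (simp add: f_def sum.distrib sum_distrib_left algebra_simps)
  qed
  have "M_AC r (Suc s) t k = (\<Sum>i=0..Suc s. (Suc s choose i) * (2 ^ i * f i))"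
    by (simp add: M_AC_def f_def mult.assoc del: binomial_Suc_Suc sum.atLeast0_atMost_Suc)
  also have "\<dots> = (\<Sum>i=0..s. (s choose i) * (2 ^ i * f i + 2 ^ Suc i * f (Suc i)))"
    using sum_choose_Suc[of s "\<lambda>i. 2 ^ i * f i"] by simp
  also have "\<dots> = M_AC (Suc r) s (Suc t) k"
    unfolding M_AC_def step by (simp add: algebra_simps)
  finally show ?thesis .
qed

text \<open>A normal form: parameters with equal \<open>r + s\<close> and equal \<open>t + s\<close>
  give equal values.\<close>

lemma M_AC_no_pairs: "M_AC r s t k = M_AC (r + s) 0 (t + s) k"
  by (induction s arbitrary: r t) (simp_all add: M_AC_Suc)

theorem theorem2p3:
  fixes r1 r2 z k :: nat
  shows "M_AC r1 r2 z k =
           (\<Sum>j=0..r1 + r2. ((r1 + r2) choose j) *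
              binom (int k + int r2 + int z - int j) (z + r2)) \<and>
         (r1 \<le> z \<longrightarrow>
           M_AC r1 r2 z k =
             (\<Sum>i=0..r1 + r2. ((r1 + r2) choose i) *
                binom (int k + int z - int r1) (i + z - r1) * 2 ^ i)) \<and>
         (z \<le> r1 \<longrightarrow>
           M_AC r1 r2 z k =
             (\<Sum>i=0..r2 + z. ((r2 + z) choose i) * 2 ^ i *
                (\<Sum>j=0..r1 - z. ((r1 - z) choose j) * binom (int k - int j) i)))"
proof (intro conjI impI)
  show "M_AC r1 r2 z k = (\<Sum>j=0..r1 + r2. ((r1 + r2) choose j) *
      binom (int k + int r2 + int z - int j) (z + r2))"
    by (subst M_AC_no_pairs) (simp add: M_AC_def add_ac)
next
  assume "r1 \<le> z"
  \<comment> \<open>Both sides have normal form \<open>M_AC (r1 + r2) 0 (z + r2) k\<close>;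
    \<open>r1 \<le> z\<close> keeps the subtraction \<open>z - r1\<close> from truncating.\<close>
  then have "M_AC r1 r2 z k = M_AC 0 (r1 + r2) (z - r1) k"
    by (simp add: M_AC_no_pairs[of r1 r2] M_AC_no_pairs[of 0])
  also have "\<dots> = (\<Sum>i=0..r1 + r2. ((r1 + r2) choose i) *
      binom (int k + int z - int r1) (i + z - r1) * 2 ^ i)"
    using \<open>r1 \<le> z\<close> by (simp add: M_AC_def of_nat_diff algebra_simps)
  finally show "M_AC r1 r2 z k = (\<Sum>i=0..r1 + r2. ((r1 + r2) choose i) *
      binom (int k + int z - int r1) (i + z - r1) * 2 ^ i)" .
next
  assume "z \<le> r1"
  then have "M_AC r1 r2 z k = M_AC (r1 - z) (r2 + z) 0 k"
    by (simp add: M_AC_no_pairs[of r1 r2] M_AC_no_pairs[of "r1 - z"] add_ac)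
  then show "M_AC r1 r2 z k = (\<Sum>i=0..r2 + z. ((r2 + z) choose i) * 2 ^ i *
      (\<Sum>j=0..r1 - z. ((r1 - z) choose j) * binom (int k - int j) i))"
    by (simp add: M_AC_def)
qed

end
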